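(* If $c\geq 2$, then $\mathit{fw}(I_{c}D_{c}I_{c}D_{c})=2c+3$.
   Context: A sequence $s$ contains a sequence $u$ if some subsequence of $s$ can be changed into $u$ by a one-to-one renaming of its letters. An $(r,s)$-formation is a concatenation of $s$ permutations of the same set of $r$ distinct letters. The formation width $\mathit{fw}(u)$ is the minimum $s$ such that there exists $r$ for which every $(r,s)$-formation contains $u$. $I_c$ denotes $1\,2\ldots c$ and $D_c$ denotes $c\,(c-1)\ldots 1$. *)

theory Defs
  imports "HOL-Library.Sublist" "HOL-Combinatorics.Multiset_Permutations"
begin

definition seq_contains :: "'a list \<Rightarrow> 'b list \<Rightarrow> bool" where
  "seq_contains s u \<longleftrightarrow>
     (\<exists>v f. subseq v s \<and> inj_on f (set v) \<and> map f v = u)"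

definition formation :: "nat \<Rightarrow> nat \<Rightarrow> 'a list \<Rightarrow> bool" where
  "formation r s xs \<longleftrightarrow>
     (\<exists>A ps. finite A \<and> card A = r \<and> length ps = s \<and>
             set ps \<subseteq> permutations_of_set A \<and> xs = concat ps)"

text \<open>
  Formations range over the infinite alphabet \<^typ>\<open>nat\<close>, so that an \<open>(r, s)\<close>-formation
  exists for all \<open>r\<close> and \<open>s\<close>; containment is invariant under renaming of letters, so the
  choice of the alphabet does not matter.
\<close>
definition fw :: "'a list \<Rightarrow> nat" where
  "fw u = (LEAST s. \<exists>r. \<forall>xs :: nat list. formation r s xs \<longrightarrow> seq_contains xs u)"

definition inc_seq :: "nat \<Rightarrow> nat list" where
  "inc_seq c = [1..<Suc c]"

definition dec_seq :: "nat \<Rightarrow> nat list" where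
  "dec_seq c = rev [1..<Suc c]"

end

theory Submission
  imports Defs "HOL-Library.Ramsey"
begin

text \<open>
  By Ramsey's theorem every long formation restricts to a binary one, each of whose
  blocks is a fixed list \<open>x\<close> or its reversal. So the theorem is a statement about sign words.
  An occurrence of \<open>I\<^sub>c D\<^sub>c I\<^sub>c D\<^sub>c\<close> is a sublist \<open>y @ rev y @ y @ rev y\<close>, where \<open>y\<close> has
  \<open>c\<close> distinct letters. In a word of length \<open>2 c + 3\<close> starting with \<open>+\<close>, the greedy
  embedding with \<open>y = x\<close> works unless the word is \<open>+\<^sup>a -\<^sup>b +\<^sup>d\<close> with
  \<open>2 \<le> a \<le> c + 1\<close>, \<open>b \<le> c + 1\<close> and \<open>d \<le> c\<close>; for these words it suffices to let \<open>y\<close>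
  rise \<open>c + 1 - a\<close> times and then fall \<open>a - 2\<close> times. Conversely, the word \<open>+\<^sup>c - - +\<^sup>c\<close>
  contains no such sublist: its runs are too short for \<open>y @ rev y\<close>, so both copies of
  \<open>hd y\<close> in the middle must use the two reversed blocks, and then one of the outer halves,
  with a single letter missing, still does not fit into \<open>+\<^sup>c\<close>.
\<close>

section \<open>Binary formations\<close>

definition blocks :: "'a list \<Rightarrow> bool list \<Rightarrow> 'a list" where
  "blocks x w = concat (map (\<lambda>s. if s then x else rev x) w)"

lemma blocks_append: "blocks x (v @ w) = blocks x v @ blocks x w"
  by (simp add: blocks_def)

text \<open>The symmetry that later allows the first sign to be taken as
  \<open>True\<close>.\<close>

lemma blocks_rev: "blocks (rev x) (map Not w) = blocks x w"
  by (induction w) (auto simp: blocks_def)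

text \<open>Every block contains every letter of \<open>x\<close>, so one letter of \<open>z\<close>
  can be taken from each block, whatever the signs.\<close>

lemma subseq_blocks_length:
  assumes "set z \<subseteq> set x" "length z \<le> length w"
  shows "subseq z (blocks x w)"
  using assms
proof (induction w arbitrary: z)
  case Nil
  then show ?case by simp
next
  case (Cons s w)
  show ?case
  proof (cases z)
    case Nil
    then show ?thesis by simp
  next
    case (Cons b z')
    have "subseq [b] (if s then x else rev x)"
      using Cons.prems Cons by (auto simp: subseq_singleton_left)
    moreover have "subseq z' (blocks x w)"
      using Cons.prems Cons by (intro Cons.IH) auto
    ultimately have "subseq ([b] @ z') ((if s then x else rev x) @ blocks x w)"
      by (rule list_emb_append_mono)
    then show ?thesis using Cons by (simp add: blocks_def)
  qed
qed

lemma subseq_blocks_mem: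
  assumes "s \<in> set w" "subseq z (if s then x else rev x)"
  shows "subseq z (blocks x w)"
proof -
  obtain u v where "w = u @ s # v" using assms(1) by (meson split_list)
  then have "blocks x w = blocks x u @ (if s then x else rev x) @ blocks x v"
    by (simp add: blocks_def)
  then show ?thesis
    using assms(2) by (metis subseq_drop_many subseq_rev_drop_many)
qed

lemma subseq_blocks_append:
  assumes "subseq y (blocks x v)" "subseq z (blocks x w)"
  shows "subseq (y @ z) (blocks x (v @ w))"
  using assms by (simp add: blocks_append list_emb_append_mono)

lemma leading_run:
  obtains n v where "w = replicate n s @ v" "v = [] \<or> (\<exists>u. v = (\<not> s) # u)"
proof
  show "w = replicate (length (takeWhile (\<lambda>t. t = s) w)) s @ dropWhile (\<lambda>t. t = s) w"
    by (metis (mono_tags) replicate_eqI set_takeWhileD takeWhile_dropWhile_id)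
  show "dropWhile (\<lambda>t. t = s) w = [] \<or> (\<exists>u. dropWhile (\<lambda>t. t = s) w = (\<not> s) # u)"
    using hd_dropWhile[of "\<lambda>t. t = s" w] by (cases "dropWhile (\<lambda>t. t = s) w") auto
qed

section \<open>The upper bound for binary formations\<close>

definition palindromic_power :: "'a list \<Rightarrow> 'a list" where
  "palindromic_power y = y @ rev y @ y @ rev y"

text \<open>The witness is \<open>y = A @ rev D\<close> with \<open>x = A @ D\<close>. Its falling
  part uses up the first run, so that the middle run can hold both \<open>rev A\<close> and most of
  the second copy of \<open>y\<close>.\<close>

lemma three_runs:
  assumes "length x = c" "a + b + d = 2 * c + 3" "2 \<le> a" "a \<le> c + 1" "b \<le> c + 1" "d \<le> c"
  shows "\<exists>y. mset y = mset x \<and> subseq (palindromic_power y)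
    (blocks x (replicate a True @ replicate b False @ replicate d True))"
proof -
  \<comment> \<open>This cut leaves \<open>D\<close> without its last letter with exactly
    \<open>a - 2\<close> letters, as many as there are blocks strictly between the first and the
    last of the leading run.\<close>
  define i where "i = c + 1 - a"
  define A where "A = take i x"
  define D where "D = drop i x"
  have x: "x = A @ D" by (simp add: A_def D_def)
  have sub: "set A \<subseteq> set x" "set D \<subseteq> set x" unfolding x by auto
  have len: "length A = i" "length D = a - 1"
    using assms unfolding A_def D_def i_def by auto
  then have "D \<noteq> []" using assms by auto
  then obtain D' l where D: "D = D' @ [l]" by (metis rev_exhaust)
  have up: "subseq (A @ [l]) x" "subseq D x" unfolding x D by (auto simp: subseq_append' intro: subseq_drop_many)
  have down: "subseq (rev A) (rev x)" unfolding x by (auto intro: subseq_drop_many)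
  \<comment> \<open>As the total is \<open>2 * c + 3\<close>, the first bound comes from
    \<open>d \<le> c\<close> and the second from \<open>b \<le> c + 1\<close>.\<close>
  have sz: "i + 2 \<le> b" "i + 1 \<le> d" using assms unfolding i_def by auto
  have w: "replicate a True @ replicate b False @ replicate d True =
      ([True] @ replicate (a - 2) True) @ [True] @ [False] @
      (replicate i False @ replicate (b - i - 1) False) @
      ([True] @ replicate (d - 1) True)"
  proof -
    have "replicate a True = ([True] @ replicate (a - 2) True) @ [True]"
      using \<open>2 \<le> a\<close> by (auto simp: le_iff_add replicate_append_same simp flip: replicate_Suc)
    moreover have "replicate b False = [False] @ (replicate i False @ replicate (b - i - 1) False)"
      using sz by (simp flip: replicate_add replicate_Suc)
    moreover have "replicate d True = [True] @ replicate (d - 1) True"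
      using sz by (cases d) auto
    ultimately show ?thesis by simp
  qed
  \<comment> \<open>A factor running in the direction of its run needs one block;
    \<open>rev D'\<close>, \<open>A\<close> and the last \<open>rev A\<close> run against it and
    take one letter per block.\<close>
  have "subseq (((A @ [l]) @ rev D') @ rev (rev D) @ rev A @ (A @ rev D) @ (rev (rev D) @ rev A))
     (blocks x (replicate a True @ replicate b False @ replicate d True))"
    unfolding w
  proof (intro subseq_blocks_append)
    show "subseq (A @ [l]) (blocks x [True])" "subseq (rev (rev D)) (blocks x [True])"
      "subseq (rev (rev D)) (blocks x [True])" "subseq (rev A) (blocks x [False])"
      using up down by (simp_all add: blocks_def)
    show "subseq (rev D') (blocks x (replicate (a - 2) True))"
      using sub len D by (intro subseq_blocks_length) auto
    show "subseq A (blocks x (replicate i False))"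
      using sub len by (intro subseq_blocks_length) auto
    show "subseq (rev D) (blocks x (replicate (b - i - 1) False))"
      using sz x by (intro subseq_blocks_mem[where s = False]) auto
    show "subseq (rev A) (blocks x (replicate (d - 1) True))"
      using sub len sz by (intro subseq_blocks_length) auto
  qed
  then have "subseq (palindromic_power (A @ rev D))
     (blocks x (replicate a True @ replicate b False @ replicate d True))"
    by (simp add: palindromic_power_def D)
  moreover have "mset (A @ rev D) = mset x" by (simp add: x)
  ultimately show ?thesis by blast
qed

lemma subseq_blocks4:
  assumes "subseq y1 (blocks x w1)" "subseq y2 (blocks x w2)"
    "subseq y3 (blocks x w3)" "subseq y4 (blocks x w4)"
  shows "subseq (y1 @ y2 @ y3 @ y4) (blocks x (w1 @ w2 @ w3 @ w4))"
  using assms by (intro subseq_blocks_append)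

lemma binary_contains_True:
  assumes "length x = c" "length w = 2 * c + 3" "w = True # w'"
  shows "\<exists>y. mset y = mset x \<and> subseq (palindromic_power y) (blocks x w)"
proof -
  \<comment> \<open>The greedy choice \<open>y = x\<close>: each factor costs either one block of
    its own sign or \<open>c\<close> arbitrary blocks.\<close>
  have const: ?thesis
    if "w = w1 @ w2 @ w3 @ w4" "True \<in> set w1" "False \<in> set w2 \<or> c \<le> length w2"
      "True \<in> set w3 \<or> c \<le> length w3" "False \<in> set w4 \<or> c \<le> length w4" for w1 w2 w3 w4
  proof -
    have up: "subseq x (blocks x v)" if "True \<in> set v \<or> c \<le> length v" for v
      using that assms(1) subseq_blocks_mem[of True v x x] subseq_blocks_length[of x x v] by auto
    have down: "subseq (rev x) (blocks x v)" if "False \<in> set v \<or> c \<le> length v" for v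
      using that assms(1) subseq_blocks_mem[of False v "rev x" x]
        subseq_blocks_length[of "rev x" x v] by auto
    have "subseq (palindromic_power x) (blocks x w)"
      unfolding palindromic_power_def that(1)
      using that by (intro subseq_blocks4 up down) auto
    then show ?thesis by blast
  qed
  obtain a u where a: "w = replicate a True @ u" "u = [] \<or> (\<exists>v. u = (\<not> True) # v)"
    by (rule leading_run)
  have "a > 0" using a assms by (cases a) auto
  show ?thesis
  proof (cases "a \<le> c + 1")
    case False
    \<comment> \<open>The first three factors use \<open>1 + c + 1\<close> blocks of the leading
      run, which leaves \<open>c + 1\<close> blocks of any sign for the last.\<close>
    then obtain k where k: "a = Suc (c + Suc k)"
      by (metis Suc_eq_plus1 add_Suc less_imp_Suc_add not_le_imp_less add_Suc_right)
    have runs: "w = [True] @ replicate c True @ [True] @ (replicate k True @ u)"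
      by (simp add: a(1) k replicate_add replicate_append_same)
    have "c \<le> length (replicate k True @ u)"
      using assms(2) by (simp add: a(1) k)
    then show ?thesis by (intro const[OF runs]) simp_all
  next
    case True
    then have "u \<noteq> []" using a assms by auto
    obtain b v where b: "u = replicate b False @ v" "v = [] \<or> (\<exists>t. v = (\<not> False) # t)"
      by (rule leading_run)
    have "b > 0" using a b \<open>u \<noteq> []\<close> by (cases b) auto
    show ?thesis
    proof (cases "b \<le> c + 1")
      case False
      then obtain k where k: "b = Suc (c + Suc k)"
        by (metis Suc_eq_plus1 add_Suc less_imp_Suc_add not_le_imp_less add_Suc_right)
      have "w = replicate a True @ [False] @ replicate c False @ (replicate (Suc k) False @ v)"
        by (simp add: a(1) b(1) k replicate_add replicate_append_same)
      then show ?thesis by (rule const) (use \<open>a > 0\<close> in auto)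
    next
      case b_le: True
      \<comment> \<open>Two runs of at most \<open>c + 1\<close> blocks fall one short of
        \<open>2 * c + 3\<close>.\<close>
      then have "v \<noteq> []" using a b assms True by auto
      obtain d t where d: "v = replicate d True @ t" "t = [] \<or> (\<exists>s. t = (\<not> True) # s)"
        by (rule leading_run)
      have "d > 0" using b d \<open>v \<noteq> []\<close> by (cases d) auto
      show ?thesis
      proof (cases "t = [] \<and> d \<le> c")
        case False
        have "w = replicate a True @ replicate b False @ [True] @ (replicate (d - 1) True @ t)"
          using \<open>d > 0\<close> by (cases d) (simp_all add: a(1) b(1) d(1))
        then show ?thesis
          by (rule const) (use False \<open>a > 0\<close> \<open>b > 0\<close> d(2) in auto)
      next
        case t: True
        then have "w = replicate a True @ replicate b False @ replicate d True"
          using a b d by simp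
        \<comment> \<open>With \<open>b \<le> c + 1\<close> and \<open>d \<le> c\<close> this total
          also gives \<open>2 \<le> a\<close>.\<close>
        moreover from this have "a + b + d = 2 * c + 3" using assms(2) by simp
        ultimately show ?thesis
          using three_runs[OF assms(1), of a b d] True b_le t by auto
      qed
    qed
  qed
qed

lemma binary_contains:
  assumes "length w = 2 * length x + 3"
  shows "\<exists>y. mset y = mset x \<and> subseq (palindromic_power y) (blocks x w)"
proof -
  obtain s w' where w: "w = s # w'" using assms by (cases w) auto
  show ?thesis
  proof (cases s)
    case True
    then show ?thesis using binary_contains_True[of x "length x" w w'] assms w by simp
  next
    case False
    have "\<exists>y. mset y = mset (rev x) \<and>
        subseq (palindromic_power y) (blocks (rev x) (map Not w))"
      using False assms w by (intro binary_contains_True[where c = "length x"]) auto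
    then show ?thesis by (simp add: blocks_rev)
  qed
qed

section \<open>Reduction to binary formations\<close>

lemma subseq_pair_antisym:
  assumes "distinct p" "subseq [a, b] p" "subseq [b, a] p"
  shows "a = b"
  using assms
proof (induction p)
  case (Cons c p)
  have "u \<in> set p \<and> v \<in> set p" if "subseq [u, v] p" for u v
    using list_emb_set[OF that, of u] list_emb_set[OF that, of v] by auto
  then show ?case
    using Cons by (auto simp: subseq_singleton_left split: if_splits)
qed simp

lemma subseq_nth_pair:
  assumes "i < j" "j < length p"
  shows "subseq [p ! i, p ! j] p"
  using assms
proof (induction p arbitrary: i j)
  case (Cons a p)
  then show ?case
    by (cases i; cases j) (auto simp: subseq_singleton_left intro: list_emb_Cons)
qed simp

text \<open>Induction on the number of permutations. Ramsey's theorem makes the first one monotone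
  on a set \<open>R\<close> of \<open>N\<close> letters; the induction hypothesis then applies to
  the others restricted to \<open>R\<close>, and passing to a subset of \<open>R\<close> keeps the
  first one monotone.\<close>

lemma simultaneously_monotone_subset:
  fixes ps :: "'a :: linorder list list"
  shows "\<exists>N. \<forall>ps A. length ps = s \<longrightarrow> finite A \<longrightarrow> N \<le> card A \<longrightarrow>
    set ps \<subseteq> permutations_of_set A \<longrightarrow>
    (\<exists>B::'a set. B \<subseteq> A \<and> card B = m \<and> (\<forall>p\<in>set ps.
      sorted_wrt (<) (filter (\<lambda>a. a \<in> B) p) \<or> sorted_wrt (>) (filter (\<lambda>a. a \<in> B) p)))"
proof (induction s)
  case 0
  show ?case by (auto intro!: exI[of _ m] dest: obtain_subset_with_card_n)
next
  case (Suc s)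
  then obtain N where N: "\<And>ps A. length ps = s \<Longrightarrow> finite A \<Longrightarrow> N \<le> card A \<Longrightarrow>
    set ps \<subseteq> permutations_of_set A \<Longrightarrow>
    (\<exists>B::'a set. B \<subseteq> A \<and> card B = m \<and> (\<forall>p\<in>set ps.
      sorted_wrt (<) (filter (\<lambda>a. a \<in> B) p) \<or> sorted_wrt (>) (filter (\<lambda>a. a \<in> B) p)))"
    by blast
  obtain r where r: "\<And>V E. finite (V :: 'a set) \<Longrightarrow> r \<le> card V \<Longrightarrow>
      \<exists>R\<subseteq>V. card R = N \<and> clique R E \<or> card R = N \<and> indep R E"
    using ramsey2[of N N, where 'a = 'a] by blast
  show ?case
  proof (intro exI[of _ r] allI impI)
    fix qs :: "'a list list" and A :: "'a set"
    assume len: "length qs = Suc s" and A: "finite A" "r \<le> card A"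
      and perms: "set qs \<subseteq> permutations_of_set A"
    obtain p ps where qs: "qs = p # ps" "length ps = s" using len by (cases qs) auto
    have p: "set p = A" "distinct p" using perms qs by (auto dest: permutations_of_setD)
    \<comment> \<open>The edges are the pairs that \<open>p\<close> lists in increasing order: a
      clique makes \<open>p\<close> increasing, an independent set makes it decreasing.\<close>
    define E where "E = {{a, b} |a b. a < b \<and> subseq [a, b] p}"
    obtain R where R: "R \<subseteq> A" "card R = N" "clique R E \<or> indep R E"
      using r[OF A, of E] by blast
    define q where "q = filter (\<lambda>a. a \<in> R) p"
    have q: "distinct q" "set q = R" "subseq q p" using p R(1) by (auto simp: q_def)
    have mono_q: "sorted_wrt (<) q \<or> sorted_wrt (>) q"
    proof -
      have pair: "q ! i \<noteq> q ! j" "q ! i \<in> R" "q ! j \<in> R"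
        "{q ! i, q ! j} \<in> E \<longleftrightarrow> q ! i < q ! j" if "i < j" "j < length q" for i j
      proof -
        show ne: "q ! i \<noteq> q ! j" and "q ! i \<in> R" "q ! j \<in> R"
          using that q(1) by (auto simp: nth_eq_iff_index_eq simp flip: q(2))
        have "subseq [q ! i, q ! j] p"
          using subseq_nth_pair[OF that] q(3) by (rule subseq_order.trans)
        then show "{q ! i, q ! j} \<in> E \<longleftrightarrow> q ! i < q ! j"
          using subseq_pair_antisym[OF p(2)] ne by (auto simp: E_def doubleton_eq_iff)
      qed
      from R(3) show ?thesis
      proof
        assume "clique R E"
        then have "sorted_wrt (<) q"
          unfolding sorted_wrt_iff_nth_less clique_def using pair by blast
        then show ?thesis ..
      next
        assume "indep R E"
        then have "sorted_wrt (>) q"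
          unfolding sorted_wrt_iff_nth_less indep_def using pair by (meson linorder_less_linear)
        then show ?thesis ..
      qed
    qed
    have "finite R" using R(1) A(1) by (rule finite_subset)
    moreover have "set (map (filter (\<lambda>a. a \<in> R)) ps) \<subseteq> permutations_of_set R"
    proof
      fix p' assume "p' \<in> set (map (filter (\<lambda>a. a \<in> R)) ps)"
      then obtain p0 where p0: "p0 \<in> set ps" "p' = filter (\<lambda>a. a \<in> R) p0" by auto
      then have "set p0 = A" "distinct p0" using perms qs by (auto dest: permutations_of_setD)
      then show "p' \<in> permutations_of_set R"
        using p0 R(1) by (auto intro!: permutations_of_setI)
    qed
    ultimately obtain B where B: "B \<subseteq> R" "card B = m" "\<forall>p\<in>set (map (filter (\<lambda>a. a \<in> R)) ps).
      sorted_wrt (<) (filter (\<lambda>a. a \<in> B) p) \<or> sorted_wrt (>) (filter (\<lambda>a. a \<in> B) p)"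
      using N[of "map (filter (\<lambda>a. a \<in> R)) ps" R] qs(2) R(2) by auto
    have restrict: "filter (\<lambda>a. a \<in> B) (filter (\<lambda>a. a \<in> R) p) = filter (\<lambda>a. a \<in> B) p" for p
      using B(1) by (auto intro!: filter_cong)
    have "sorted_wrt (<) (filter (\<lambda>a. a \<in> B) p) \<or> sorted_wrt (>) (filter (\<lambda>a. a \<in> B) p)"
      using mono_q sorted_wrt_filter restrict[of p] unfolding q_def by metis
    then show "\<exists>B. B \<subseteq> A \<and> card B = m \<and> (\<forall>p\<in>set qs.
      sorted_wrt (<) (filter (\<lambda>a. a \<in> B) p) \<or> sorted_wrt (>) (filter (\<lambda>a. a \<in> B) p))"
      using B R(1) qs by (intro exI[of _ B]) (auto simp: restrict simp del: filter_filter)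
  qed
qed

text \<open>On \<open>B\<close>, a monotone permutation is the sorted list of \<open>B\<close> or
  its reverse; \<open>w\<close> records which.\<close>

lemma binary_restriction:
  fixes B :: "'a :: linorder set"
  assumes "finite A" "B \<subseteq> A" "set ps \<subseteq> permutations_of_set A"
    and "\<forall>p\<in>set ps. sorted_wrt (<) (filter (\<lambda>a. a \<in> B) p) \<or> sorted_wrt (>) (filter (\<lambda>a. a \<in> B) p)"
  shows "\<exists>w. length w = length ps \<and> subseq (blocks (sorted_list_of_set B) w) (concat ps)"
  using assms(3,4)
proof (induction ps)
  case Nil
  then show ?case by (simp add: blocks_def)
next
  case (Cons p ps)
  then obtain w where w: "length w = length ps"
    "subseq (blocks (sorted_list_of_set B) w) (concat ps)"
    by auto
  let ?q = "filter (\<lambda>a. a \<in> B) p" and ?x = "sorted_list_of_set B"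
  have p: "set p = A" using Cons.prems by (auto dest: permutations_of_setD)
  have sets: "set ?q = B" using p assms(2) by auto
  have "?q = ?x \<or> rev ?q = ?x"
  proof -
    have "?q = ?x" if "sorted_wrt (<) ?q"
      using that sets strict_sorted_equal[of ?q ?x] assms(1,2) by (simp add: finite_subset)
    moreover have "rev ?q = ?x" if "sorted_wrt (>) ?q"
    proof -
      have "sorted_wrt (<) (rev ?q)" using that by (simp add: sorted_wrt_rev)
      then show ?thesis
        using sets strict_sorted_equal[of "rev ?q" ?x] assms(1,2) by (simp add: finite_subset)
    qed
    ultimately show ?thesis using Cons.prems(2) by auto
  qed
  then obtain s where "?q = (if s then ?x else rev ?x)"
    by (metis rev_rev_ident)
  then have "subseq (if s then ?x else rev ?x) p" by (metis subseq_filter_left)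
  then have "subseq (blocks ?x (s # w)) (concat (p # ps))"
    using w(2) by (simp add: blocks_def list_emb_append_mono)
  then show ?case using w(1) by (intro exI[of _ "s # w"]) simp
qed

section \<open>Containment of the pattern up to renaming\<close>

lemma rename_distinct:
  assumes "distinct y" "distinct z" "length y = length z"
  obtains f where "inj_on f (set y)" "map f y = z"
proof
  let ?f = "\<lambda>a. the (map_of (zip y z) a)"
  show *: "map ?f y = z"
    using assms by (auto intro!: nth_equalityI simp: map_of_zip_nth)
  show "inj_on ?f (set y)"
    using assms(2) * by (metis distinct_map)
qed

text \<open>The renaming is injective on the letters of \<open>v\<close>, so the four factors of the
  pattern pull back to one list and its reversals. Conversely, any \<open>c\<close> distinct letters
  can be renamed to \<open>inc_seq c\<close>.\<close>

lemma seq_contains_iff: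
  "seq_contains s (inc_seq c @ dec_seq c @ inc_seq c @ dec_seq c) \<longleftrightarrow>
     (\<exists>y. distinct y \<and> length y = c \<and> subseq (palindromic_power y) s)"
proof
  assume "seq_contains s (inc_seq c @ dec_seq c @ inc_seq c @ dec_seq c)"
  then obtain v f where v: "subseq v s" "inj_on f (set v)"
    "map f v = inc_seq c @ dec_seq c @ inc_seq c @ dec_seq c"
    by (auto simp: seq_contains_def)
  from v(3) obtain v1 w1 where 1: "v = v1 @ w1" "inc_seq c = map f v1"
    "map f w1 = dec_seq c @ inc_seq c @ dec_seq c"
    by (metis map_eq_append_conv)
  from 1(3) obtain v2 w2 where 2: "w1 = v2 @ w2" "dec_seq c = map f v2"
    "map f w2 = inc_seq c @ dec_seq c"
    by (metis map_eq_append_conv)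
  from 2(3) obtain v3 v4 where 3: "w2 = v3 @ v4" "inc_seq c = map f v3" "dec_seq c = map f v4"
    by (metis map_eq_append_conv)
  note split = 1(1)[unfolded 2(1) 3(1)] 1(2)[symmetric] 2(2)[symmetric] 3(2,3)[symmetric]
  have eq: "z = z'" if "map f z = map f z'" "set z \<subseteq> set v" "set z' \<subseteq> set v" for z z'
    using that v(2) by (metis inj_on_Un inj_on_map_eq_map inj_on_subset le_sup_iff)
  have "v2 = rev v1" "v3 = v1" "v4 = rev v1"
    by (rule eq; use split in \<open>auto simp: rev_map[symmetric] inc_seq_def dec_seq_def\<close>)+
  moreover have "distinct v1" "length v1 = c"
    using split(2) by (metis distinct_map distinct_upt inc_seq_def,
      metis diff_Suc_1 inc_seq_def length_map length_upt)
  ultimately show "\<exists>y. distinct y \<and> length y = c \<and> subseq (palindromic_power y) s"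
    using v(1) split(1) by (auto simp: palindromic_power_def)
next
  assume "\<exists>y. distinct y \<and> length y = c \<and> subseq (palindromic_power y) s"
  then obtain y where y: "distinct y" "length y = c" "subseq (palindromic_power y) s" by blast
  obtain f where f: "inj_on f (set y)" "map f y = inc_seq c"
    using rename_distinct[of y "inc_seq c"] y by (auto simp: inc_seq_def simp del: upt_Suc)
  have "set (palindromic_power y) = set y" by (auto simp: palindromic_power_def)
  moreover have "map f (palindromic_power y) = inc_seq c @ dec_seq c @ inc_seq c @ dec_seq c"
    using f(2) by (simp add: palindromic_power_def rev_map[symmetric]) (simp add: inc_seq_def dec_seq_def)
  ultimately show "seq_contains s (inc_seq c @ dec_seq c @ inc_seq c @ dec_seq c)"
    using y(3) f(1) unfolding seq_contains_def by metis
qed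

lemma long_formation_contains:
  "\<exists>r. \<forall>xs :: nat list. formation r (2 * c + 3) xs \<longrightarrow>
    (\<exists>y. distinct y \<and> length y = c \<and> subseq (palindromic_power y) xs)"
proof -
  \<comment> \<open>A common monotone set of only \<open>c\<close> letters is enough, since
    \<open>binary_contains\<close> finds a \<open>y\<close> that is a rearrangement of
    \<open>x\<close>.\<close>
  obtain N where N: "\<And>ps A. length ps = 2 * c + 3 \<Longrightarrow> finite A \<Longrightarrow> N \<le> card A \<Longrightarrow>
    set ps \<subseteq> permutations_of_set A \<Longrightarrow>
    (\<exists>B::nat set. B \<subseteq> A \<and> card B = c \<and> (\<forall>p\<in>set ps.
      sorted_wrt (<) (filter (\<lambda>a. a \<in> B) p) \<or> sorted_wrt (>) (filter (\<lambda>a. a \<in> B) p)))"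
    using simultaneously_monotone_subset by metis
  show ?thesis
  proof (intro exI[of _ N] allI impI)
    fix xs :: "nat list"
    assume "formation N (2 * c + 3) xs"
    then obtain A ps where F: "finite A" "card A = N" "length ps = 2 * c + 3"
      "set ps \<subseteq> permutations_of_set A" "xs = concat ps"
      by (auto simp: formation_def)
    then obtain B where B: "B \<subseteq> A" "card B = c" "\<forall>p\<in>set ps.
      sorted_wrt (<) (filter (\<lambda>a. a \<in> B) p) \<or> sorted_wrt (>) (filter (\<lambda>a. a \<in> B) p)"
      using N[of ps A] by auto
    let ?x = "sorted_list_of_set B"
    obtain w where w: "length w = length ps" "subseq (blocks ?x w) xs"
      using binary_restriction[OF F(1) B(1) F(4) B(3)] F(5) by blast
    have len: "length ?x = c" using B(2) by simp
    obtain y where y: "mset y = mset ?x" "subseq (palindromic_power y) (blocks ?x w)"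
      using binary_contains[of w ?x] w(1) F(3) len by auto
    have "distinct y" "length y = c"
      using mset_eq_imp_distinct_iff[OF y(1)] mset_eq_length[OF y(1)] len by auto
    then show "\<exists>y. distinct y \<and> length y = c \<and> subseq (palindromic_power y) xs"
      using y(2) w(2) subseq_order.trans by blast
  qed
qed

section \<open>The lower bound\<close>

text \<open>Each nonascent forces an embedding into repeated increasing blocks to move on to a new
  block. Equal neighbours count too, because a block has each letter only once.\<close>

fun nonascents :: "'a :: linorder list \<Rightarrow> nat" where
  "nonascents (a # b # z) = (if a < b then 0 else 1) + nonascents (b # z)"
| "nonascents _ = 0"

lemma nonascents_append:
  "nonascents (y @ a # z) = nonascents (y @ [a]) + nonascents (a # z)"
  by (induction y rule: nonascents.induct) auto

lemma nonascents_append_sorted_le: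
  assumes "sorted_wrt (<) y"
  shows "nonascents (y @ z) \<le> Suc (nonascents z)"
  using assms
proof (induction y rule: nonascents.induct)
  case ("2_2" a)
  then show ?case by (cases z) auto
qed auto

lemma subseq_sorted_wrt:
  "subseq y x \<Longrightarrow> sorted_wrt P x \<Longrightarrow> sorted_wrt P y"
  by (induction rule: list_emb.induct) (auto dest: list_emb_set)

lemma subseq_rev: "subseq y x \<Longrightarrow> subseq (rev y) (rev x)"
  by (induction rule: list_emb.induct) (auto intro: subseq_rev_drop_many)

text \<open>Each block receives an increasing piece of \<open>z\<close>, so nonascents occur only at
  the junctions, of which there are at most \<open>m - 1\<close>.\<close>

lemma nonascents_less:
  assumes "subseq z (concat (replicate m x))" "sorted_wrt (<) x" "z \<noteq> []"
  shows "nonascents z < m"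
  using assms(1,3)
proof (induction m arbitrary: z)
  case 0
  then show ?case by simp
next
  case (Suc m)
  from Suc.prems(1) obtain z1 z2 where z: "z = z1 @ z2" "subseq z1 x"
    "subseq z2 (concat (replicate m x))"
    by (auto simp: subseq_append_iff)
  have s: "nonascents z \<le> Suc (nonascents z2)"
    using nonascents_append_sorted_le[OF subseq_sorted_wrt[OF z(2) assms(2)], of z2] z(1) by simp
  show ?case
  proof (cases "z2 = []")
    case True
    have "nonascents z1 = 0" if "sorted_wrt (<) z1" for z1 :: "'a list"
      using that by (induction z1 rule: nonascents.induct) auto
    then show ?thesis using True z subseq_sorted_wrt[OF z(2) assms(2)] by simp
  next
    case False
    then show ?thesis using Suc.IH[OF z(3)] s by simp
  qed
qed

text \<open>Each adjacent pair of \<open>y\<close> is a nonascent in exactly one of \<open>y\<close>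
  and \<open>rev y\<close>, and the repeated middle letter adds one more.\<close>

lemma nonascents_append_rev:
  assumes "distinct y" "y \<noteq> []"
  shows "nonascents (y @ rev y) = length y"
  using assms
proof (induction y)
  case (Cons a y)
  show ?case
  proof (cases y)
    case Nil
    then show ?thesis by simp
  next
    case (Cons b z)
    have "nonascents ((a # b # z) @ rev (a # b # z))
        = (if a < b then 0 else 1) + nonascents ((b # z @ rev z) @ b # [a])"
      by simp
    also have "\<dots> = (if a < b then 0 else 1) + nonascents (y @ rev y) + nonascents [b, a]"
      by (subst nonascents_append) (simp add: Cons)
    finally show ?thesis
      using Cons.IH Cons.prems Cons by auto
  qed
qed simp

text \<open>Dropping an end letter costs nothing when the lost pair was an ascent. So, however
  \<open>a\<close> and \<open>b\<close> compare, one of the two truncations keeps as many nonascents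
  as the full palindrome.\<close>

lemma nonascents_append_rev_truncated:
  assumes "distinct (a # b # z)"
  shows "a > b \<Longrightarrow> nonascents (a # (b # z) @ rev (b # z)) = length z + 2"
    and "a < b \<Longrightarrow> nonascents ((b # z) @ rev (b # z) @ [a]) = length z + 2"
  using nonascents_append_rev[of "b # z"] assms nonascents_append[of "(b # z) @ rev z" b "[a]"]
  by auto

text \<open>With \<open>y = a # b # z\<close>, the palindrome \<open>a # T @ [a]\<close> does not
  fit into \<open>P\<close>, which traps the two middle letters \<open>a\<close> in the reversed
  blocks. A truncation that still does not fit into \<open>P\<close> then pushes a neighbouring
  \<open>b\<close> in there too, and two blocks cannot hold these three letters.\<close>

lemma blocks_avoid:
  fixes x y :: "'a :: linorder list"
  assumes x: "sorted_wrt (<) x" and y: "distinct y" "length y \<ge> 2"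
  defines "P \<equiv> concat (replicate (length y) x)"
  shows "\<not> subseq (palindromic_power y) (P @ (rev x @ rev x) @ P)"
proof
  assume "subseq (palindromic_power y) (P @ (rev x @ rev x) @ P)"
  moreover obtain a b z where abz: "y = a # b # z"
    using y(2) by (metis One_nat_def Suc_1 Suc_le_length_iff)
  define T where "T = (b # z) @ rev (b # z)"
  have pp: "palindromic_power y = (a # T) @ [a, a] @ (T @ [a])"
    by (simp add: palindromic_power_def abz T_def)
  ultimately obtain U1 U2 U3 where U: "(a # T) @ [a, a] @ (T @ [a]) = U1 @ U2 @ U3"
    "subseq U1 P" "subseq U2 (rev x @ rev x)" "subseq U3 P"
    by (metis subseq_append_iff)
  \<comment> \<open>The bracketings show \<open>a # T @ [a]\<close> as a prefix and as a suffix, to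
    be compared with \<open>U1\<close> and \<open>U3\<close>.\<close>
  have pp': "palindromic_power y = (a # T @ [a]) @ [a] @ T @ [a]"
    "palindromic_power y = ((a # T) @ [a]) @ (a # T @ [a])"
    by (simp_all add: pp)
  have U': "palindromic_power y = U1 @ U2 @ U3" "palindromic_power y = (U1 @ U2) @ U3"
    using U(1) by (simp_all add: pp)
  have long: "\<not> subseq z' P" if "nonascents z' \<ge> length y" for z'
    using that nonascents_less[of z' "length y" x] x y(2) unfolding P_def
    by (cases "z' = []") auto
  have full: "\<not> subseq (a # T @ [a]) P"
    using nonascents_append_rev[of y] y by (intro long) (auto simp: abz T_def)
  \<comment> \<open>Reversal turns the two middle blocks into increasing ones, where
    \<open>nonascents_less\<close> applies.\<close>
  have two: "nonascents (rev u) < 2" if "subseq u (rev x @ rev x)" "u \<noteq> []" for u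
  proof -
    have "subseq (rev u) (concat (replicate 2 x))"
      using that(1) subseq_rev[of u "rev x @ rev x"] by (simp add: numeral_2_eq_2)
    then show ?thesis using nonascents_less x that(2) by blast
  qed
  have U1: "length U1 \<le> length (a # T)"
  proof (rule ccontr)
    assume too_long: "\<not> ?thesis"
    have "prefix (a # T @ [a]) U1"
      using prefixI[OF pp'(1)] prefixI[OF U'(1)] by (rule prefix_length_prefix) (use too_long in simp)
    then show False using full U(2) by (meson prefix_imp_subseq subseq_order.trans)
  qed
  have U3: "length U3 \<le> length (T @ [a])"
  proof (rule ccontr)
    assume too_long: "\<not> ?thesis"
    have "suffix (a # T @ [a]) U3"
      using suffixI[OF pp'(2)] suffixI[OF U'(2)] by (rule suffix_length_suffix) (use too_long in simp)
    then show False using full U(4) by (meson suffix_imp_subseq subseq_order.trans)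
  qed
  have "prefix U1 (a # T)"
    using prefixI[OF U'(1)] prefixI[OF pp] U1 by (rule prefix_length_prefix)
  then obtain L where L: "a # T = U1 @ L" by (auto simp: prefix_def)
  have "suffix U3 (T @ [a])"
    using suffixI[OF U'(2)] suffixI[of _ "(a # T) @ [a, a]"] U3
    by (rule suffix_length_suffix) (simp add: pp)
  then obtain R where R: "T @ [a] = R @ U3" by (auto simp: suffix_def)
  have U2: "U2 = L @ [a, a] @ R"
    using U(1) unfolding L R by simp
  have "a \<noteq> b" using y abz by auto
  then consider "a > b" | "a < b" by fastforce
  then show False
  proof cases
    case 1
    \<comment> \<open>For \<open>a > b\<close> the truncation \<open>a # T\<close> does not fit into
      \<open>P\<close>, so \<open>U1\<close> is a proper prefix of it and the final \<open>b\<close>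
      of \<open>T\<close> falls into \<open>U2\<close>.\<close>
    have "L \<noteq> []"
      using L U(2) long[of "a # T"] nonascents_append_rev_truncated(1)[of a b z] 1 y abz by (auto simp: T_def)
    then obtain L' where "L = L' @ [b]"
      using L by (cases L rule: rev_cases) (auto simp: T_def simp flip: append_Cons append_assoc)
    then have "subseq [b, a, a] U2" by (auto simp: U2)
    then have "subseq [b, a, a] (rev x @ rev x)" using U(3) by (rule subseq_order.trans)
    then have "nonascents (rev [b, a, a]) < 2" by (rule two) simp
    then show False using 1 by (simp split: if_splits)
  next
    case 2
    \<comment> \<open>Symmetrically, for \<open>a < b\<close> the truncation \<open>T @ [a]\<close>
      is too long for the last \<open>P\<close>, and its first letter \<open>b\<close> falls into
      \<open>U2\<close>.\<close>
    have "R \<noteq> []"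
      using R U(4) long[of "T @ [a]"] nonascents_append_rev_truncated(2)[of a b z] 2 y abz by (auto simp: T_def)
    then obtain R' where "R = b # R'"
      using R by (cases R) (auto simp: T_def)
    then have "subseq [a, a, b] U2" by (auto simp: U2)
    then have "subseq [a, a, b] (rev x @ rev x)" using U(3) by (rule subseq_order.trans)
    then have "nonascents (rev [a, a, b]) < 2" by (rule two) simp
    then show False using 2 by (simp split: if_splits)
  qed
qed

text \<open>For every \<open>r\<close>, the avoiding word with \<open>2 * c + 2\<close> blocks gives
  all shorter lengths through its prefixes, since avoidance passes to sublists.\<close>

lemma short_formation_avoids:
  assumes "c \<ge> 2" "s < 2 * c + 3"
  obtains xs :: "nat list" where "formation r s xs"
    "\<And>y. distinct y \<Longrightarrow> length y = c \<Longrightarrow> \<not> subseq (palindromic_power y) xs"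
proof
  let ?x = "[0..<r]"
  let ?ps = "replicate c ?x @ [rev ?x, rev ?x] @ replicate c ?x"
  have "set (take s ?ps) \<subseteq> set ?ps" by (rule set_take_subset)
  also have "\<dots> \<subseteq> permutations_of_set {0..<r}" by (auto split: if_splits)
  finally have "set (take s ?ps) \<subseteq> permutations_of_set {0..<r}" .
  moreover have "length (take s ?ps) = s" using assms(2) by simp
  ultimately show "formation r s (concat (take s ?ps))"
    unfolding formation_def by (metis card_atLeastLessThan diff_zero finite_atLeastLessThan)
  fix y :: "nat list"
  assume y: "distinct y" "length y = c"
  have "concat ?ps = concat (take s ?ps) @ concat (drop s ?ps)"
    by (metis append_take_drop_id concat_append)
  then have "subseq (concat (take s ?ps)) (concat ?ps)" by (metis subseq_rev_drop_many subseq_order.refl)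
  moreover have "\<not> subseq (palindromic_power y) (concat ?ps)"
    using blocks_avoid[of ?x y] y assms(1) by simp
  ultimately show "\<not> subseq (palindromic_power y) (concat (take s ?ps))"
    using subseq_order.trans by blast
qed

theorem theorem5p5:
  fixes c :: nat
  assumes "c \<ge> 2"
  shows "fw (inc_seq c @ dec_seq c @ inc_seq c @ dec_seq c) = 2 * c + 3"
  unfolding fw_def seq_contains_iff
proof (rule Least_equality)
  show "\<exists>r. \<forall>xs :: nat list. formation r (2 * c + 3) xs \<longrightarrow>
      (\<exists>y. distinct y \<and> length y = c \<and> subseq (palindromic_power y) xs)"
    by (rule long_formation_contains)
next
  fix s
  assume "\<exists>r. \<forall>xs :: nat list. formation r s xs \<longrightarrow>
      (\<exists>y. distinct y \<and> length y = c \<and> subseq (palindromic_power y) xs)"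
  then show "2 * c + 3 \<le> s"
    using short_formation_avoids[OF assms] by (metis not_le_imp_less)
qed

end
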